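(* Let $(X,\kappa)$ be a Lefschetz complex, let $\mathcal V$ be a combinatorial multivector field on $X$, and assume that $X$ is invariant with respect to $\mathcal V$. For a subset $Q\subseteq X$ the following conditions are equivalent: (i) $Q$ is a repeller; (ii) $Q$ is invariant and open; (iii) $Q$ is isolated invariant and open; (iv) $Q$ is isolated invariant, open and a backward trapping region.
   Context: Fix a ring $R$ with unity. A Lefschetz complex $(X,\kappa)$ is a finite set $X=\bigsqcup_{q\ge 0}X_q$ graded by non-negative integers with a map $\kappa:X\times X\to R$ such that $\kappa(x,y)\ne 0$ implies $x\in X_q$, $y\in X_{q-1}$ for some $q$, and $\sum_{y\in X}\kappa(x,y)\kappa(y,z)=0$ for all $x,z\in X$. Let $\le_\kappa$ be the smallest partial order on $X$ with $y\le_\kappa x$ whenever $\kappa(x,y)\neq 0$. $X$ carries the topology whose open sets are the upper sets of $\le_\kappa$, so $\operatorname{cl}A=\{y\in X: y\le_\kappa x\text{ for some }x\in A\}$; $\operatorname{cl}x=\operatorname{cl}\{x\}$, $\operatorname{mo}A:=\operatorname{cl}A\setminus A$. A set $A$ is proper if $\operatorname{mo}A$ is closed. The Lefschetz homology $H^\kappa(X)$ is the homology of the free chain complex $R(X)$ with basis $X$ and $\partial x=\sum_y\kappa(x,y)y$; a proper subset with the restricted $\kappa$ is again a Lefschetz complex. A multivector is a proper $V\subseteq X$ with a unique maximal element $V^\star$ with respect to $\le_\kappa$; it is regular if $H^\kappa(V)=0$ and critical otherwise. A combinatorial multivector field $\mathcal V$ on $X$ is a partition of $X$ into multivectors; $[x]$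 is the multivector containing $x$ and $x^\star:=[x]^\star$. Define $\Pi_{\mathcal V}:X\to\mathcal P(X)$ by: $y\in\Pi_{\mathcal V}(x)$ iff (a) $x\ne y=x^\star$, or (b) $x=x^\star$ and $y\in\operatorname{cl}x\setminus[x]$, or (c) $x=x^\star=y$ and $[x]$ is critical. Put $\Pi_{\mathcal V}^{-1}(N)=\{x\in X:\Pi_{\mathcal V}(x)\cap N\neq\emptyset\}$. A solution is a map $\varphi$ from an interval of $\mathbb Z$ to $X$ with $\varphi(i+1)\in\Pi_{\mathcal V}(\varphi(i))$ whenever $i,i+1$ are in the domain; it is full if its domain is $\mathbb Z$ and a path if its domain is finite. $\operatorname{Sol}(x,A)$ is the set of full solutions with values in $A$ and with $x$ among their values. $A$ is $\mathcal V$-compatible if $x\in A$ implies $[x]\subseteq A$; $[A]_{\mathcal V}^-$ is the largest $\mathcal V$-compatible subset of $A$. $\operatorname{Inv}A:=\{x\in A:\operatorname{Sol}(x^\star,[A]_{\mathcal V}^-)\ne\emptyset\}$; $A$ is invariant if $\operatorname{Inv}A=A$. An isolated invariant set is an invariant set $S$ such that there is no path $\varphi$ whose values at both endpoints of its domain lie in $S$, with $\operatorname{im}\varphi\subseteq\operatorname{cl}S$ and $\operatorname{im}\varphi\cap\operatorname{mo}S\neq\emptyset$. A backward trapping region is a $\mathcal V$-compatible $N\subseteq X$ with $\Pi_{\mathcal V}^{-1}(N)\subseteq N$. A repeller is a set of the form $\operatorname{Inv}N$ with $N$ a backward trapping region. *)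

theory Defs
  imports
    "HOL-Analysis.Abstract_Topology"
    "HOL-Algebra.Elementary_Groups"
    "HOL-Library.Disjoint_Sets"
begin

section \<open>Lefschetz complexes\<close>

text \<open>
  A finite set of cells graded by \<open>dimension\<close> (so that the cells of degree \<open>q\<close> are those of
  dimension \<open>q\<close>) together with the incidence coefficients. The values of \<open>dimension\<close> and
  \<open>incidence\<close> outside the set of cells play no role.
\<close>

record ('a, 'r) complex_data =
  cells :: "'a set"
  dimension :: "'a \<Rightarrow> nat"
  incidence :: "'a \<Rightarrow> 'a \<Rightarrow> 'r"

text \<open>
  The sort \<open>{ring, monoid_mult}\<close> describes (possibly noncommutative) rings with unity. Unlike in
  the class \<open>ring_1\<close>, the equation \<open>0 = 1\<close> is not excluded.
\<close>

definition lefschetz_complex :: "('a, 'r::{ring, monoid_mult}) complex_data \<Rightarrow> bool" where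
  "lefschetz_complex K \<longleftrightarrow>
     finite (cells K) \<and>
     (\<forall>x\<in>cells K. \<forall>y\<in>cells K. incidence K x y \<noteq> 0 \<longrightarrow> dimension K x = dimension K y + 1) \<and>
     (\<forall>x\<in>cells K. \<forall>z\<in>cells K. (\<Sum>y\<in>cells K. incidence K x y * incidence K y z) = 0)"

text \<open>The pair \<open>(y, x)\<close> belongs to \<open>face_order K\<close> iff \<open>y\<close> is below \<open>x\<close>.\<close>

definition face_order :: "('a, 'r::{ring, monoid_mult}) complex_data \<Rightarrow> 'a rel" where
  "face_order K =
     \<Inter>{r. partial_order_on (cells K) r \<and>
         (\<forall>x\<in>cells K. \<forall>y\<in>cells K. incidence K x y \<noteq> 0 \<longrightarrow> (y, x) \<in> r)}"

definition lefschetz_topology :: "('a, 'r::{ring, monoid_mult}) complex_data \<Rightarrow> 'a topology" where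
  "lefschetz_topology K =
     topology (\<lambda>U. U \<subseteq> cells K \<and> (\<forall>x\<in>U. \<forall>y\<in>cells K. (x, y) \<in> face_order K \<longrightarrow> y \<in> U))"

abbreviation lef_cl :: "('a, 'r::{ring, monoid_mult}) complex_data \<Rightarrow> 'a set \<Rightarrow> 'a set" where
  "lef_cl K A \<equiv> lefschetz_topology K closure_of A"

definition mouth :: "('a, 'r::{ring, monoid_mult}) complex_data \<Rightarrow> 'a set \<Rightarrow> 'a set" where
  "mouth K A = lef_cl K A - A"

definition proper_subset :: "('a, 'r::{ring, monoid_mult}) complex_data \<Rightarrow> 'a set \<Rightarrow> bool" where
  "proper_subset K A \<longleftrightarrow> A \<subseteq> cells K \<and> closedin (lefschetz_topology K) (mouth K A)"


section \<open>Lefschetz homology\<close>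

text \<open>
  The degree \<open>q\<close> part of the free module on the cells: coefficient functions supported on the
  (finitely many) cells of dimension \<open>q\<close>.
\<close>

definition chain_group :: "('a, 'r::{ring, monoid_mult}) complex_data \<Rightarrow> nat \<Rightarrow> ('a \<Rightarrow> 'r) monoid" where
  "chain_group K q =
     \<lparr>carrier = {c. \<forall>x. c x \<noteq> 0 \<longrightarrow> x \<in> cells K \<and> dimension K x = q},
      mult = (\<lambda>c d x. c x + d x),
      one = (\<lambda>x. 0)\<rparr>"

text \<open>Coefficients act from the left: the chain \<open>\<Sum>x. c x \<cdot> x\<close> is sent to \<open>\<Sum>x. c x \<cdot> \<partial>x\<close>.\<close>

definition boundary ::
    "('a, 'r::{ring, monoid_mult}) complex_data \<Rightarrow> ('a \<Rightarrow> 'r) \<Rightarrow> ('a \<Rightarrow> 'r)" where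
  "boundary K c = (\<lambda>y. if y \<in> cells K then \<Sum>x\<in>cells K. c x * incidence K x y else 0)"

definition cycles :: "('a, 'r::{ring, monoid_mult}) complex_data \<Rightarrow> nat \<Rightarrow> ('a \<Rightarrow> 'r) set" where
  "cycles K q = {c \<in> carrier (chain_group K q). boundary K c = (\<lambda>y. 0)}"

definition boundaries :: "('a, 'r::{ring, monoid_mult}) complex_data \<Rightarrow> nat \<Rightarrow> ('a \<Rightarrow> 'r) set" where
  "boundaries K q = boundary K ` carrier (chain_group K (q + 1))"

definition lefschetz_homology ::
    "('a, 'r::{ring, monoid_mult}) complex_data \<Rightarrow> nat \<Rightarrow> ('a \<Rightarrow> 'r) set monoid" where
  "lefschetz_homology K q = (chain_group K q)\<lparr>carrier := cycles K q\<rparr> Mod boundaries K q"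

definition zero_homology :: "('a, 'r::{ring, monoid_mult}) complex_data \<Rightarrow> bool" where
  "zero_homology K \<longleftrightarrow> (\<forall>q. trivial_group (lefschetz_homology K q))"


section \<open>Combinatorial multivector fields\<close>

definition maximal_cell :: "('a, 'r::{ring, monoid_mult}) complex_data \<Rightarrow> 'a set \<Rightarrow> 'a \<Rightarrow> bool" where
  "maximal_cell K V x \<longleftrightarrow> x \<in> V \<and> (\<forall>y\<in>V. (x, y) \<in> face_order K \<longrightarrow> y = x)"

definition multivector :: "('a, 'r::{ring, monoid_mult}) complex_data \<Rightarrow> 'a set \<Rightarrow> bool" where
  "multivector K V \<longleftrightarrow> proper_subset K V \<and> (\<exists>!x. maximal_cell K V x)"

definition mv_top :: "('a, 'r::{ring, monoid_mult}) complex_data \<Rightarrow> 'a set \<Rightarrow> 'a" where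
  "mv_top K V = (THE x. maximal_cell K V x)"

definition regular_mv :: "('a, 'r::{ring, monoid_mult}) complex_data \<Rightarrow> 'a set \<Rightarrow> bool" where
  "regular_mv K V \<longleftrightarrow> multivector K V \<and> zero_homology (K\<lparr>cells := V\<rparr>)"

definition critical_mv :: "('a, 'r::{ring, monoid_mult}) complex_data \<Rightarrow> 'a set \<Rightarrow> bool" where
  "critical_mv K V \<longleftrightarrow> multivector K V \<and> \<not> regular_mv K V"

definition multivector_field ::
    "('a, 'r::{ring, monoid_mult}) complex_data \<Rightarrow> 'a set set \<Rightarrow> bool" where
  "multivector_field K \<V> \<longleftrightarrow> partition_on (cells K) \<V> \<and> (\<forall>V\<in>\<V>. multivector K V)"

definition mv_of :: "'a set set \<Rightarrow> 'a \<Rightarrow> 'a set" where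
  "mv_of \<V> x = (THE V. V \<in> \<V> \<and> x \<in> V)"

definition top_of :: "('a, 'r::{ring, monoid_mult}) complex_data \<Rightarrow> 'a set set \<Rightarrow> 'a \<Rightarrow> 'a" where
  "top_of K \<V> x = mv_top K (mv_of \<V> x)"

definition Pi_mv :: "('a, 'r::{ring, monoid_mult}) complex_data \<Rightarrow> 'a set set \<Rightarrow> 'a \<Rightarrow> 'a set" where
  "Pi_mv K \<V> x =
     {y \<in> cells K.
        (x \<noteq> y \<and> y = top_of K \<V> x) \<or>
        (x = top_of K \<V> x \<and> y \<in> lef_cl K {x} - mv_of \<V> x) \<or>
        (x = top_of K \<V> x \<and> x = y \<and> critical_mv K (mv_of \<V> x))}"

definition Pi_mv_inverse ::
    "('a, 'r::{ring, monoid_mult}) complex_data \<Rightarrow> 'a set set \<Rightarrow> 'a set \<Rightarrow> 'a set" where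
  "Pi_mv_inverse K \<V> N = {x \<in> cells K. Pi_mv K \<V> x \<inter> N \<noteq> {}}"


section \<open>Solutions, invariance and repellers\<close>

definition int_interval :: "int set \<Rightarrow> bool" where
  "int_interval I \<longleftrightarrow> (\<forall>i\<in>I. \<forall>k\<in>I. {i..k} \<subseteq> I)"

text \<open>A solution with domain \<open>I\<close> is a total function of which only the values on \<open>I\<close> matter.\<close>

definition solution_on ::
    "('a, 'r::{ring, monoid_mult}) complex_data \<Rightarrow> 'a set set \<Rightarrow> int set \<Rightarrow> (int \<Rightarrow> 'a) \<Rightarrow> bool" where
  "solution_on K \<V> I \<phi> \<longleftrightarrow>
     int_interval I \<and> \<phi> ` I \<subseteq> cells K \<and>
     (\<forall>i. i \<in> I \<and> i + 1 \<in> I \<longrightarrow> \<phi> (i + 1) \<in> Pi_mv K \<V> (\<phi> i))"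

definition Sol ::
    "('a, 'r::{ring, monoid_mult}) complex_data \<Rightarrow> 'a set set \<Rightarrow> 'a \<Rightarrow> 'a set \<Rightarrow> (int \<Rightarrow> 'a) set" where
  "Sol K \<V> x A = {\<phi>. solution_on K \<V> UNIV \<phi> \<and> range \<phi> \<subseteq> A \<and> x \<in> range \<phi>}"

definition mv_compatible ::
    "('a, 'r::{ring, monoid_mult}) complex_data \<Rightarrow> 'a set set \<Rightarrow> 'a set \<Rightarrow> bool" where
  "mv_compatible K \<V> A \<longleftrightarrow> A \<subseteq> cells K \<and> (\<forall>x\<in>A. mv_of \<V> x \<subseteq> A)"

text \<open>Compatible sets are closed under unions, so this is the largest compatible subset of \<open>A\<close>.\<close>

definition mv_kernel ::
    "('a, 'r::{ring, monoid_mult}) complex_data \<Rightarrow> 'a set set \<Rightarrow> 'a set \<Rightarrow> 'a set" where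
  "mv_kernel K \<V> A = \<Union>{B. B \<subseteq> A \<and> mv_compatible K \<V> B}"

definition Inv_part ::
    "('a, 'r::{ring, monoid_mult}) complex_data \<Rightarrow> 'a set set \<Rightarrow> 'a set \<Rightarrow> 'a set" where
  "Inv_part K \<V> A = {x \<in> A. Sol K \<V> (top_of K \<V> x) (mv_kernel K \<V> A) \<noteq> {}}"

definition invariant_set ::
    "('a, 'r::{ring, monoid_mult}) complex_data \<Rightarrow> 'a set set \<Rightarrow> 'a set \<Rightarrow> bool" where
  "invariant_set K \<V> A \<longleftrightarrow> A \<subseteq> cells K \<and> Inv_part K \<V> A = A"

definition isolated_invariant_set ::
    "('a, 'r::{ring, monoid_mult}) complex_data \<Rightarrow> 'a set set \<Rightarrow> 'a set \<Rightarrow> bool" where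
  "isolated_invariant_set K \<V> S \<longleftrightarrow>
     invariant_set K \<V> S \<and>
     (\<nexists>I \<phi>. finite I \<and> I \<noteq> {} \<and> solution_on K \<V> I \<phi> \<and>
        \<phi> (Min I) \<in> S \<and> \<phi> (Max I) \<in> S \<and>
        \<phi> ` I \<subseteq> lef_cl K S \<and> \<phi> ` I \<inter> mouth K S \<noteq> {})"

definition backward_trapping_region ::
    "('a, 'r::{ring, monoid_mult}) complex_data \<Rightarrow> 'a set set \<Rightarrow> 'a set \<Rightarrow> bool" where
  "backward_trapping_region K \<V> N \<longleftrightarrow> mv_compatible K \<V> N \<and> Pi_mv_inverse K \<V> N \<subseteq> N"

definition repeller ::
    "('a, 'r::{ring, monoid_mult}) complex_data \<Rightarrow> 'a set set \<Rightarrow> 'a set \<Rightarrow> bool" where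
  "repeller K \<V> Q \<longleftrightarrow> (\<exists>N. backward_trapping_region K \<V> N \<and> Q = Inv_part K \<V> N)"


section \<open>Consistency of the definitions\<close>

lemma partial_order_face_order:
  assumes "lefschetz_complex K"
  shows "partial_order_on (cells K) (face_order K)"
proof -
  let ?R = "{r. partial_order_on (cells K) r \<and>
         (\<forall>x\<in>cells K. \<forall>y\<in>cells K. incidence K x y \<noteq> 0 \<longrightarrow> (y, x) \<in> r)}"
  let ?r = "{(y, x). y \<in> cells K \<and> x \<in> cells K \<and> (y = x \<or> dimension K y < dimension K x)}"
  have "partial_order_on (cells K) ?r"
    by (auto simp: partial_order_on_def preorder_on_def refl_on_def trans_def antisym_def)
  then have ne: "?r \<in> ?R"
    using assms by (auto simp: lefschetz_complex_def)
  have po: "r \<subseteq> cells K \<times> cells K" "refl_on (cells K) r" "trans r" "antisym r" if "r \<in> ?R" for r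
    using that by (auto simp: partial_order_on_def preorder_on_def)
  have "\<Inter>?R \<subseteq> cells K \<times> cells K" "antisym (\<Inter>?R)"
    using ne po[OF ne] by (blast, meson Inter_lower antisym_subset)
  moreover have "refl_on (cells K) (\<Inter>?R)"
    using po(2) unfolding refl_on_def by blast
  moreover have "trans (\<Inter>?R)"
    using po(3) unfolding trans_def by blast
  ultimately show ?thesis
    unfolding face_order_def partial_order_on_def preorder_on_def by blast
qed

lemma openin_lefschetz_topology:
  "openin (lefschetz_topology K) U \<longleftrightarrow>
     U \<subseteq> cells K \<and> (\<forall>x\<in>U. \<forall>y\<in>cells K. (x, y) \<in> face_order K \<longrightarrow> y \<in> U)"
proof -
  have "istopology
      (\<lambda>U. U \<subseteq> cells K \<and> (\<forall>x\<in>U. \<forall>y\<in>cells K. (x, y) \<in> face_order K \<longrightarrow> y \<in> U))"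
    unfolding istopology_def by blast
  then show ?thesis
    by (simp add: lefschetz_topology_def topology_inverse')
qed

lemma topspace_lefschetz_topology: "topspace (lefschetz_topology K) = cells K"
proof (rule equalityI)
  show "topspace (lefschetz_topology K) \<subseteq> cells K"
    using openin_topspace[of "lefschetz_topology K"] unfolding openin_lefschetz_topology by simp
  show "cells K \<subseteq> topspace (lefschetz_topology K)"
    by (rule openin_subset) (simp add: openin_lefschetz_topology)
qed

lemma lef_cl_eq:
  assumes "lefschetz_complex K" "A \<subseteq> cells K"
  shows "lef_cl K A = {y. \<exists>x\<in>A. (y, x) \<in> face_order K}"
proof (intro Set.set_eqI iffI)
  have po: "face_order K \<subseteq> cells K \<times> cells K" "refl_on (cells K) (face_order K)"
      "trans (face_order K)"
    using partial_order_face_order[OF assms(1)] by (auto simp: partial_order_on_def preorder_on_def)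
  fix y
  show "y \<in> {y. \<exists>x\<in>A. (y, x) \<in> face_order K}" if y: "y \<in> lef_cl K A"
  proof -
    have yc: "y \<in> cells K"
      using y by (simp add: in_closure_of topspace_lefschetz_topology)
    let ?U = "{z. (y, z) \<in> face_order K}"
    have "openin (lefschetz_topology K) ?U"
      using po(1,3) unfolding openin_lefschetz_topology trans_def by blast
    moreover have "y \<in> ?U"
      using po(2) yc by (simp add: refl_on_def)
    ultimately obtain x where "x \<in> A" "x \<in> ?U"
      using y unfolding in_closure_of by meson
    then show ?thesis
      by blast
  qed
  assume "y \<in> {y. \<exists>x\<in>A. (y, x) \<in> face_order K}"
  then obtain x where x: "x \<in> A" "(y, x) \<in> face_order K"
    by blast
  have "x \<in> T" if "openin (lefschetz_topology K) T" "y \<in> T" for T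
    using that x assms(2) unfolding openin_lefschetz_topology by auto
  then show "y \<in> lef_cl K A"
    using x po(1) unfolding in_closure_of topspace_lefschetz_topology by auto
qed

lemma lefschetz_complex_restrict:
  assumes K: "lefschetz_complex K" and V: "proper_subset K V"
  shows "lefschetz_complex (K\<lparr>cells := V\<rparr>)"
proof -
  have sub: "V \<subseteq> cells K" and cl: "closedin (lefschetz_topology K) (mouth K V)"
    using V by (auto simp: proper_subset_def)
  have fin: "finite (cells K)"
    using K by (simp add: lefschetz_complex_def)
  have face: "(y, x) \<in> face_order K"
    if "x \<in> cells K" "y \<in> cells K" "incidence K x y \<noteq> 0" for x y
    using that by (auto simp: face_order_def)
  have msub: "mouth K V \<subseteq> cells K"
    using closedin_subset[OF cl] by (simp add: topspace_lefschetz_topology)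
  have zero: "incidence K x y * incidence K y z = 0"
    if x: "x \<in> V" and z: "z \<in> V" and y: "y \<in> cells K - V" for x y z
  proof (rule ccontr)
    assume "incidence K x y * incidence K y z \<noteq> 0"
    then have "(y, x) \<in> face_order K" "(z, y) \<in> face_order K"
      using face x y z sub by (metis DiffD1 mult_zero_left subsetD, metis DiffD1 mult_zero_right subsetD)
    then have "y \<in> mouth K V" "z \<in> lef_cl K (mouth K V)"
      using x y lef_cl_eq[OF K sub] lef_cl_eq[OF K msub] by (auto simp: mouth_def)
    then have "z \<in> mouth K V"
      using closure_of_closedin[OF cl] by simp
    then show False
      using z by (simp add: mouth_def)
  qed
  have "(\<Sum>y\<in>V. incidence K x y * incidence K y z) = 0" if "x \<in> V" "z \<in> V" for x z
  proof -
    have "(\<Sum>y\<in>V. incidence K x y * incidence K y z) =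
        (\<Sum>y\<in>cells K. incidence K x y * incidence K y z)"
      by (rule sum.mono_neutral_left) (use fin sub zero that in auto)
    also have "\<dots> = 0"
      using K that sub unfolding lefschetz_complex_def by blast
    finally show ?thesis .
  qed
  moreover have "dimension K x = dimension K y + 1"
    if "x \<in> V" "y \<in> V" "incidence K x y \<noteq> 0" for x y
    using K that sub unfolding lefschetz_complex_def by blast
  ultimately show ?thesis
    using finite_subset[OF sub fin] by (simp add: lefschetz_complex_def)
qed

lemma comm_group_chain_group: "comm_group (chain_group K q)"
proof (rule comm_groupI)
  fix c assume c: "c \<in> carrier (chain_group K q)"
  then show "\<exists>d\<in>carrier (chain_group K q). d \<otimes>\<^bsub>chain_group K q\<^esub> c = \<one>\<^bsub>chain_group K q\<^esub>"
    by (intro bexI[of _ "\<lambda>x. - c x"]) (auto simp: chain_group_def)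
qed (simp_all add: chain_group_def fun_eq_iff add.assoc add.commute, metis add_0)

lemma boundary_add: "boundary K (\<lambda>x. c x + d x) = (\<lambda>x. boundary K c x + boundary K d x)"
  by (auto simp: boundary_def distrib_right sum.distrib)

lemma boundary_boundary:
  assumes "lefschetz_complex K"
  shows "boundary K (boundary K c) = (\<lambda>x. 0)"
proof
  fix z
  have "(\<Sum>y\<in>cells K. (\<Sum>x\<in>cells K. c x * incidence K x y) * incidence K y z) =
      (\<Sum>x\<in>cells K. c x * (\<Sum>y\<in>cells K. incidence K x y * incidence K y z))"
    unfolding sum_distrib_left sum_distrib_right mult.assoc by (rule sum.swap)
  also have "\<dots> = 0" if "z \<in> cells K"
    using assms that by (simp add: lefschetz_complex_def)
  finally show "boundary K (boundary K c) z = 0"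
    by (simp add: boundary_def)
qed

lemma boundaries_subset_cycles:
  assumes "lefschetz_complex K"
  shows "boundaries K q \<subseteq> cycles K q"
proof -
  have "boundary K c \<in> carrier (chain_group K q)" if c: "c \<in> carrier (chain_group K (q + 1))" for c
  proof -
    have "y \<in> cells K \<and> dimension K y = q" if y: "boundary K c y \<noteq> 0" for y
    proof -
      from y obtain x where "x \<in> cells K" "c x * incidence K x y \<noteq> 0" "y \<in> cells K"
        unfolding boundary_def by (metis (mono_tags, lifting) sum.neutral)
      moreover from this have "c x \<noteq> 0" "incidence K x y \<noteq> 0"
        by auto
      ultimately show ?thesis
        using assms c by (auto simp: lefschetz_complex_def chain_group_def)
    qed
    then show ?thesis
      by (simp add: chain_group_def)
  qed
  then show ?thesis
    using boundary_boundary[OF assms] by (auto simp: boundaries_def cycles_def)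
qed

lemma comm_group_lefschetz_homology:
  assumes "lefschetz_complex K"
  shows "comm_group (lefschetz_homology K q)"
proof -
  let ?C = "chain_group K"
  interpret C: comm_group "?C q" by (rule comm_group_chain_group)
  have m: "c \<otimes>\<^bsub>?C q\<^esub> d = (\<lambda>x. c x + d x)" "\<one>\<^bsub>?C q\<^esub> = (\<lambda>x. 0)" for c d q
    by (simp_all add: chain_group_def)
  have zero: "boundary K (\<lambda>x. 0) = (\<lambda>x. 0)"
    by (simp add: boundary_def fun_eq_iff)
  have hom: "boundary K \<in> hom (?C (q + 1)) (?C q)" for q
  proof (rule homI)
    show "boundary K c \<in> carrier (?C q)" if "c \<in> carrier (?C (q + 1))" for c
      using boundaries_subset_cycles[OF assms, of q] that unfolding boundaries_def cycles_def by blast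
  qed (simp add: m boundary_add)
  have inv: "inv\<^bsub>?C q\<^esub> c = (\<lambda>x. - c x)" if "c \<in> carrier (?C q)" for c
  proof (rule C.inv_equality)
    show "(\<lambda>x. - c x) \<in> carrier (?C q)"
      using that by (simp add: chain_group_def)
  qed (use that in \<open>simp_all add: m\<close>)
  have uminus: "boundary K (\<lambda>x. - c x) = (\<lambda>x. - boundary K c x)" for c
    by (simp add: boundary_def fun_eq_iff sum_negf)
  have Z: "subgroup (cycles K q) (?C q)"
  proof (rule C.subgroupI)
    show "cycles K q \<subseteq> carrier (?C q)"
      unfolding cycles_def by blast
    have "(\<lambda>x. 0) \<in> cycles K q"
      using C.one_closed zero unfolding m cycles_def by blast
    then show "cycles K q \<noteq> {}"
      by blast
    fix c assume c: "c \<in> cycles K q"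
    then have cC: "c \<in> carrier (?C q)" "boundary K c = (\<lambda>x. 0)"
      unfolding cycles_def by blast+
    show "inv\<^bsub>?C q\<^esub> c \<in> cycles K q"
      using C.inv_closed[OF cC(1)] unfolding inv[OF cC(1)] by (simp add: cycles_def uminus cC(2))
    fix d assume "d \<in> cycles K q"
    then have dC: "d \<in> carrier (?C q)" "boundary K d = (\<lambda>x. 0)"
      unfolding cycles_def by blast+
    show "c \<otimes>\<^bsub>?C q\<^esub> d \<in> cycles K q"
      using C.m_closed[OF cC(1) dC(1)] unfolding m by (simp add: cycles_def boundary_add cC(2) dC(2))
  qed
  have B: "subgroup (boundaries K q) (?C q)"
  proof -
    interpret h: group_hom "?C (q + 1)" "?C q" "boundary K"
      by (intro group_hom.intro group_hom_axioms.intro hom comm_group.axioms(2) comm_group_chain_group)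
    show ?thesis
      unfolding boundaries_def by (rule h.img_is_subgroup)
  qed
  interpret Z: comm_group "?C q\<lparr>carrier := cycles K q\<rparr>"
    using subgroup.mem_carrier[OF Z]
    by (intro group.group_comm_groupI subgroup.subgroup_is_group[OF Z] C.is_group)
      (simp_all add: C.m_comm)
  have "subgroup (boundaries K q) (?C q\<lparr>carrier := cycles K q\<rparr>)"
    by (rule C.subgroup_incl[OF B Z boundaries_subset_cycles[OF assms]])
  then show ?thesis
    unfolding lefschetz_homology_def by (rule Z.abelian_FactGroup)
qed

end

theory Submission
  imports Defs
begin

text \<open>
  A backward trapping region is open, since a cell above one of its cells is dominated by the top of
  its own multivector, from which the region is reached in one step; conversely an open compatible
  set is a backward trapping region. Invariance of the whole complex supplies a backward solution
  from every top cell, and backward solutions never leave a backward trapping region \<open>N\<close>.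
  Hence only forward solutions decide membership in \<open>Inv N\<close>, so \<open>Inv N\<close> is itself a backward
  trapping region. A path ending in a backward trapping region stays in it, which gives isolation.
\<close>

section \<open>Half-orbits and full solutions\<close>

definition forward_solvable ::
    "('a, 'r::{ring, monoid_mult}) complex_data \<Rightarrow> 'a set set \<Rightarrow> 'a set \<Rightarrow> 'a \<Rightarrow> bool" where
  "forward_solvable K \<V> A x \<longleftrightarrow>
     (\<exists>f::nat \<Rightarrow> 'a. f 0 = x \<and> (\<forall>n. f n \<in> A \<and> f (Suc n) \<in> Pi_mv K \<V> (f n)))"

text \<open>The index counts steps into the past: \<open>g (Suc n)\<close> is a predecessor of
  \<open>g n\<close>.\<close>

definition backward_solvable ::
    "('a, 'r::{ring, monoid_mult}) complex_data \<Rightarrow> 'a set set \<Rightarrow> 'a set \<Rightarrow> 'a \<Rightarrow> bool" where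
  "backward_solvable K \<V> A x \<longleftrightarrow>
     (\<exists>g::nat \<Rightarrow> 'a. g 0 = x \<and> (\<forall>n. g n \<in> A \<and> g n \<in> Pi_mv K \<V> (g (Suc n))))"

text \<open>A full solution is cut at a time when it visits \<open>x\<close>; conversely, two
  half-orbits are glued at time 0. This lets the past and the future of a cell be treated
  independently.\<close>

lemma Sol_nonempty_iff:
  assumes "A \<subseteq> cells K"
  shows "Sol K \<V> x A \<noteq> {} \<longleftrightarrow> forward_solvable K \<V> A x \<and> backward_solvable K \<V> A x"
proof
  assume "Sol K \<V> x A \<noteq> {}"
  then obtain \<phi> where "\<phi> \<in> Sol K \<V> x A"
    by blast
  then obtain i where \<phi>: "\<And>k. \<phi> (k + 1) \<in> Pi_mv K \<V> (\<phi> k)" "range \<phi> \<subseteq> A" "\<phi> i = x"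
    by (auto simp: Sol_def solution_on_def)
  have "\<phi> (i - int n) \<in> Pi_mv K \<V> (\<phi> (i - int (Suc n)))" for n
    using \<phi>(1)[of "i - int (Suc n)"] by simp
  then have "backward_solvable K \<V> A x"
    unfolding backward_solvable_def using \<phi> by (intro exI[of _ "\<lambda>n. \<phi> (i - int n)"]) auto
  moreover have "\<phi> (i + int (Suc n)) \<in> Pi_mv K \<V> (\<phi> (i + int n))" for n
    using \<phi>(1)[of "i + int n"] by (simp add: algebra_simps)
  then have "forward_solvable K \<V> A x"
    unfolding forward_solvable_def using \<phi> by (intro exI[of _ "\<lambda>n. \<phi> (i + int n)"]) auto
  ultimately show "forward_solvable K \<V> A x \<and> backward_solvable K \<V> A x"
    by blast
next
  assume "forward_solvable K \<V> A x \<and> backward_solvable K \<V> A x"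
  then obtain f g where f: "f 0 = x" "\<And>n. f n \<in> A" "\<And>n. f (Suc n) \<in> Pi_mv K \<V> (f n)"
    and g: "g 0 = x" "\<And>n. g n \<in> A" "\<And>n. g n \<in> Pi_mv K \<V> (g (Suc n))"
    unfolding forward_solvable_def backward_solvable_def by metis
  define \<phi> where "\<phi> k = (if 0 \<le> k then f (nat k) else g (nat (- k)))" for k :: int
  have "\<phi> (k + 1) \<in> Pi_mv K \<V> (\<phi> k)" for k
  proof (cases "0 \<le> k")
    case True
    then show ?thesis
      using f(3)[of "nat k"] by (simp add: \<phi>_def nat_add_distrib)
  next
    case False
    define n where "n = nat (- k - 1)"
    have k: "k = - int (Suc n)"
      using False by (simp add: n_def)
    \<comment> \<open>At \<open>m = 0\<close> the definition of \<open>\<phi>\<close> selects the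
      branch \<open>f\<close>, so the gluing rests on \<open>f 0 = x = g 0\<close>.\<close>
    have "\<phi> (- int m) = g m" for m
      using f(1) g(1) by (cases "m = 0") (simp_all add: \<phi>_def)
    then have "\<phi> (- int n) = g n" "\<phi> k = g (Suc n)"
      unfolding k by blast+
    moreover have "k + 1 = - int n"
      by (simp add: k)
    ultimately show ?thesis
      using g(3)[of n] by simp
  qed
  moreover have "range \<phi> \<subseteq> A"
    using f(2) g(2) by (auto simp: \<phi>_def)
  moreover have "\<phi> 0 = x"
    using f(1) by (simp add: \<phi>_def)
  ultimately have "\<phi> \<in> Sol K \<V> x A"
    using assms by (auto simp: Sol_def solution_on_def int_interval_def)
  then show "Sol K \<V> x A \<noteq> {}"
    by blast
qed

lemma forward_solvable_step:
  assumes "x \<in> A" "y \<in> Pi_mv K \<V> x" "forward_solvable K \<V> A y"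
  shows "forward_solvable K \<V> A x"
proof -
  obtain f where f: "f 0 = y" "\<And>n. f n \<in> A" "\<And>n. f (Suc n) \<in> Pi_mv K \<V> (f n)"
    using assms(3) unfolding forward_solvable_def by metis
  have "case_nat x f n \<in> A \<and> case_nat x f (Suc n) \<in> Pi_mv K \<V> (case_nat x f n)" for n
    using f assms(1,2) by (cases n) auto
  then show ?thesis
    unfolding forward_solvable_def by (intro exI[of _ "case_nat x f"]) simp
qed

text \<open>Since \<open>N\<close> absorbs predecessors, induction along the past of
  \<open>x\<close> keeps every cell of it in \<open>N\<close>.\<close>

lemma backward_solvable_trapping:
  assumes N: "backward_trapping_region K \<V> N" and "x \<in> N"
    and "backward_solvable K \<V> (cells K) x"
  shows "backward_solvable K \<V> N x"
proof -
  obtain g where g: "g 0 = x" "\<And>n. g n \<in> cells K" "\<And>n. g n \<in> Pi_mv K \<V> (g (Suc n))"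
    using assms(3) unfolding backward_solvable_def by metis
  have "g n \<in> N" for n
  proof (induction n)
    case (Suc n)
    then show ?case
      using N g(2)[of "Suc n"] g(3)[of n]
      unfolding backward_trapping_region_def Pi_mv_inverse_def by blast
  qed (use g(1) assms(2) in simp)
  then show ?thesis
    using g unfolding backward_solvable_def by blast
qed

section \<open>Compatible kernels and isolation of trapping regions\<close>

lemma mv_kernel_subset: "mv_kernel K \<V> A \<subseteq> A" "mv_kernel K \<V> A \<subseteq> cells K"
  unfolding mv_kernel_def mv_compatible_def by blast+

lemma mv_compatible_kernel: "mv_compatible K \<V> (mv_kernel K \<V> A)"
  unfolding mv_kernel_def mv_compatible_def by blast

lemma mv_kernel_compatible: "mv_compatible K \<V> A \<Longrightarrow> mv_kernel K \<V> A = A"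
  unfolding mv_kernel_def by blast

lemma backward_trapping_isolated:
  assumes "backward_trapping_region K \<V> Q" "invariant_set K \<V> Q"
  shows "isolated_invariant_set K \<V> Q"
  unfolding isolated_invariant_set_def
proof (intro conjI notI assms(2))
  assume "\<exists>I \<phi>. finite I \<and> I \<noteq> {} \<and> solution_on K \<V> I \<phi> \<and>
        \<phi> (Min I) \<in> Q \<and> \<phi> (Max I) \<in> Q \<and>
        \<phi> ` I \<subseteq> lef_cl K Q \<and> \<phi> ` I \<inter> mouth K Q \<noteq> {}"
  then obtain I \<phi> where I: "finite I" "solution_on K \<V> I \<phi>" "\<phi> (Max I) \<in> Q"
    and "\<phi> ` I \<inter> mouth K Q \<noteq> {}"
    by blast
  then obtain i where i: "i \<in> I" "\<phi> i \<notin> Q"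
    by (auto simp: mouth_def)
  have mem: "k \<in> I" if "i \<le> k" "k \<le> Max I" for k
    using I(2) Max_in[OF I(1)] i(1) that unfolding solution_on_def int_interval_def
    by (metis atLeastAtMost_iff empty_iff subsetD)
  \<comment> \<open>Downward induction from the right endpoint to the time \<open>i\<close>, where
    the path lies in the mouth and hence outside \<open>Q\<close>.\<close>
  have "\<phi> k \<in> Q" if "k \<le> Max I" "i \<le> k" for k
    using that
  proof (induction rule: int_le_induct)
    case base
    show ?case by (rule I(3))
  next
    case (step k)
    have k: "k - 1 \<in> I" "k \<in> I"
      using mem step by auto
    then have "\<phi> k \<in> Pi_mv K \<V> (\<phi> (k - 1))" "\<phi> (k - 1) \<in> cells K"
      using I(2) unfolding solution_on_def by (metis diff_add_cancel, blast)
    moreover have "\<phi> k \<in> Q"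
      using step by simp
    ultimately have "\<phi> (k - 1) \<in> Pi_mv_inverse K \<V> Q"
      by (auto simp: Pi_mv_inverse_def)
    then show ?case
      using assms(1) by (auto simp: backward_trapping_region_def)
  qed
  moreover have "i \<le> Max I"
    using I(1) i(1) by simp
  ultimately show False
    using i(2) by blast
qed

section \<open>Multivectors and their top cells\<close>

locale multivector_field_on =
  fixes K :: "('a, 'r::{ring, monoid_mult}) complex_data" and \<V> :: "'a set set"
  assumes complex: "lefschetz_complex K" and field: "multivector_field K \<V>"
begin

lemma face_order_facts:
  "face_order K \<subseteq> cells K \<times> cells K" "refl_on (cells K) (face_order K)"
  "trans (face_order K)" "antisym (face_order K)"
  using partial_order_face_order[OF complex] by (auto simp: partial_order_on_def preorder_on_def)

lemma mv_of_eq: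
  assumes "V \<in> \<V>" "x \<in> V"
  shows "mv_of \<V> x = V"
proof -
  have "disjoint \<V>"
    using field by (simp add: multivector_field_def partition_on_def)
  then show ?thesis
    unfolding mv_of_def using assms by (intro the_equality) (auto simp: disjoint_def)
qed

lemma mv_of_in:
  assumes "x \<in> cells K"
  shows "mv_of \<V> x \<in> \<V>" "x \<in> mv_of \<V> x"
proof -
  obtain V where "V \<in> \<V>" "x \<in> V"
    using field assms by (auto simp: multivector_field_def partition_on_def)
  then show "mv_of \<V> x \<in> \<V>" "x \<in> mv_of \<V> x"
    using mv_of_eq by auto
qed

lemma mv_of_subset: "x \<in> cells K \<Longrightarrow> mv_of \<V> x \<subseteq> cells K"
  using field mv_of_in(1) by (auto simp: multivector_field_def partition_on_def)

lemma mv_of_mv_of: "x \<in> cells K \<Longrightarrow> y \<in> mv_of \<V> x \<Longrightarrow> mv_of \<V> y = mv_of \<V> x"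
  using mv_of_in(1) mv_of_eq by blast

lemma top_of_maximal:
  assumes "x \<in> cells K"
  shows "maximal_cell K (mv_of \<V> x) (top_of K \<V> x)"
proof -
  have "\<exists>!t. maximal_cell K (mv_of \<V> x) t"
    using field mv_of_in(1)[OF assms] by (auto simp: multivector_field_def multivector_def)
  then show ?thesis
    unfolding top_of_def mv_top_def by (rule theI')
qed

lemma top_of_in: "x \<in> cells K \<Longrightarrow> top_of K \<V> x \<in> mv_of \<V> x"
  using top_of_maximal by (simp add: maximal_cell_def)

lemma top_of_in_cells: "x \<in> cells K \<Longrightarrow> top_of K \<V> x \<in> cells K"
  using top_of_in mv_of_subset by blast

lemma mv_of_top_of: "x \<in> cells K \<Longrightarrow> mv_of \<V> (top_of K \<V> x) = mv_of \<V> x"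
  using mv_of_mv_of top_of_in by blast

lemma top_of_top_of: "x \<in> cells K \<Longrightarrow> top_of K \<V> (top_of K \<V> x) = top_of K \<V> x"
  using mv_of_top_of by (simp add: top_of_def)

text \<open>By finiteness, a unique maximal element dominates the whole multivector.\<close>

lemma face_order_top_of:
  assumes x: "x \<in> cells K"
  shows "(x, top_of K \<V> x) \<in> face_order K"
proof -
  let ?up = "\<lambda>z. {w \<in> mv_of \<V> x. (z, w) \<in> face_order K}"
  have fin: "finite (mv_of \<V> x)"
    using complex mv_of_subset[OF x] by (auto simp: lefschetz_complex_def intro: finite_subset)
  have x_up: "x \<in> ?up x"
    using face_order_facts(2) mv_of_in(2)[OF x] x by (simp add: refl_on_def)
  \<comment> \<open>Among the cells of the multivector above \<open>x\<close>, \<open>t\<close> has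
    the fewest cells of the multivector above it. This makes it maximal, and uniqueness then
    identifies it with the top.\<close>
  obtain t where t: "t \<in> ?up x" and least: "\<And>w. w \<in> ?up x \<Longrightarrow> card (?up t) \<le> card (?up w)"
    using ex_has_least_nat[of "\<lambda>w. w \<in> ?up x" x "\<lambda>w. card (?up w)"] x_up by blast
  have "maximal_cell K (mv_of \<V> x) t"
    unfolding maximal_cell_def
  proof (intro conjI ballI impI)
    fix y assume y: "y \<in> mv_of \<V> x" "(t, y) \<in> face_order K"
    have "?up y \<subseteq> ?up t"
      using face_order_facts(3) y by (auto dest: transD)
    moreover have "y \<in> ?up x"
      using face_order_facts(3) t y by (auto dest: transD)
    \<comment> \<open>An inclusion of finite sets without drop in cardinality is an equality, so
      \<open>t\<close> is also above \<open>y\<close>.\<close>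
    ultimately have "?up y = ?up t"
      using fin least by (intro card_seteq) auto
    moreover have "t \<in> ?up t"
      using face_order_facts(1,2) t y by (auto simp: refl_on_def)
    ultimately show "y = t"
      using face_order_facts(4) y(2) by (auto dest: antisymD)
  qed (use t in simp)
  then have "t = top_of K \<V> x"
    using field mv_of_in(1)[OF x] top_of_maximal[OF x]
    by (auto simp: multivector_field_def multivector_def)
  then show ?thesis
    using t by simp
qed

lemma lef_cl_singleton: "x \<in> cells K \<Longrightarrow> y \<in> lef_cl K {x} \<longleftrightarrow> (y, x) \<in> face_order K"
  using lef_cl_eq[OF complex, of "{x}"] by simp

lemma mv_compatible_top_iff:
  assumes "mv_compatible K \<V> A" "x \<in> cells K"
  shows "top_of K \<V> x \<in> A \<longleftrightarrow> x \<in> A"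
  using assms(1) mv_of_top_of[OF assms(2)] mv_of_in(2)[OF assms(2)] top_of_in[OF assms(2)]
  unfolding mv_compatible_def by auto

lemma mv_compatible_cells: "mv_compatible K \<V> (cells K)"
  using mv_of_subset by (simp add: mv_compatible_def)

section \<open>Invariant parts\<close>

lemma Inv_part_iff:
  "x \<in> Inv_part K \<V> A \<longleftrightarrow> x \<in> A \<and> forward_solvable K \<V> (mv_kernel K \<V> A) (top_of K \<V> x) \<and>
     backward_solvable K \<V> (mv_kernel K \<V> A) (top_of K \<V> x)"
  by (simp add: Inv_part_def Sol_nonempty_iff[OF mv_kernel_subset(2)])

text \<open>The witnessing solution passes through the top of \<open>x\<close> inside the kernel,
  and compatibility of the kernel passes from the top to \<open>x\<close>.\<close>

lemma Inv_part_subset_kernel: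
  assumes "A \<subseteq> cells K"
  shows "Inv_part K \<V> A \<subseteq> mv_kernel K \<V> A"
proof
  fix x assume "x \<in> Inv_part K \<V> A"
  then have "x \<in> cells K" "top_of K \<V> x \<in> mv_kernel K \<V> A"
    using assms by (auto simp: Inv_part_def Sol_def)
  then show "x \<in> mv_kernel K \<V> A"
    using mv_compatible_top_iff[OF mv_compatible_kernel] by blast
qed

text \<open>The solution condition sees a cell only through its top, which is shared by its whole
  multivector; the preceding lemma puts that multivector inside \<open>A\<close>.\<close>

lemma mv_compatible_Inv_part:
  assumes "A \<subseteq> cells K"
  shows "mv_compatible K \<V> (Inv_part K \<V> A)"
  unfolding mv_compatible_def
proof (intro conjI ballI subsetI)
  show "x \<in> cells K" if "x \<in> Inv_part K \<V> A" for x
    using that assms by (auto simp: Inv_part_def)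
  fix x y assume x: "x \<in> Inv_part K \<V> A" and y: "y \<in> mv_of \<V> x"
  have "x \<in> mv_kernel K \<V> A"
    using x Inv_part_subset_kernel[OF assms] by blast
  then have "y \<in> A" "x \<in> cells K"
    using y mv_compatible_kernel[of K \<V> A] mv_kernel_subset[of K \<V> A]
    by (auto simp: mv_compatible_def)
  moreover from this have "top_of K \<V> y = top_of K \<V> x"
    using y mv_of_mv_of by (simp add: top_of_def)
  ultimately show "y \<in> Inv_part K \<V> A"
    using x by (simp add: Inv_part_def)
qed

text \<open>Each value of \<open>\<phi>\<close> is its own top or is followed by its top, so
  \<open>\<phi>\<close> itself is the solution through the top that membership requires.\<close>

lemma solution_in_Inv_part:
  assumes "solution_on K \<V> UNIV \<phi>" "range \<phi> \<subseteq> mv_kernel K \<V> A"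
  shows "range \<phi> \<subseteq> Inv_part K \<V> A"
proof
  fix y assume "y \<in> range \<phi>"
  then obtain i where i: "y = \<phi> i" by blast
  have "\<phi> (i + 1) \<in> Pi_mv K \<V> y"
    using assms(1) by (simp add: solution_on_def i)
  then have "top_of K \<V> y = \<phi> i \<or> top_of K \<V> y = \<phi> (i + 1)"
    using i by (auto simp: Pi_mv_def)
  then have "top_of K \<V> y \<in> range \<phi>"
    by auto
  moreover have "y \<in> A"
    using \<open>y \<in> range \<phi>\<close> assms(2) mv_kernel_subset(1)[of K \<V> A] by blast
  ultimately show "y \<in> Inv_part K \<V> A"
    using assms by (auto simp: Inv_part_def Sol_def)
qed

text \<open>A solution that witnesses membership never leaves the invariant part, and this part,
  being compatible, is its own kernel. Hence the same solution serves as witness again.\<close>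

lemma invariant_Inv_part:
  assumes "A \<subseteq> cells K"
  shows "invariant_set K \<V> (Inv_part K \<V> A)"
proof -
  have compat: "mv_compatible K \<V> (Inv_part K \<V> A)"
    by (rule mv_compatible_Inv_part[OF assms])
  have "x \<in> Inv_part K \<V> (Inv_part K \<V> A)" if x: "x \<in> Inv_part K \<V> A" for x
  proof -
    obtain \<phi> where \<phi>: "\<phi> \<in> Sol K \<V> (top_of K \<V> x) (mv_kernel K \<V> A)"
      using x by (auto simp: Inv_part_def)
    then have "range \<phi> \<subseteq> Inv_part K \<V> A"
      by (intro solution_in_Inv_part) (auto simp: Sol_def)
    then have "\<phi> \<in> Sol K \<V> (top_of K \<V> x) (Inv_part K \<V> A)"
      using \<phi> by (auto simp: Sol_def)
    then show ?thesis
      using x unfolding Inv_part_def[of K \<V> "Inv_part K \<V> A"] mv_kernel_compatible[OF compat]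
      by blast
  qed
  then have "Inv_part K \<V> (Inv_part K \<V> A) = Inv_part K \<V> A"
    by (auto simp: Inv_part_def[of K \<V> "Inv_part K \<V> A"])
  then show ?thesis
    using compat by (simp add: invariant_set_def mv_compatible_def)
qed

section \<open>Backward trapping regions and open sets\<close>

lemma backward_trapping_open:
  assumes N: "backward_trapping_region K \<V> N"
  shows "openin (lefschetz_topology K) N"
  unfolding openin_lefschetz_topology
proof (intro conjI ballI impI)
  have compat: "mv_compatible K \<V> N"
    using N by (simp add: backward_trapping_region_def)
  then show "N \<subseteq> cells K"
    by (simp add: mv_compatible_def)
  fix x y assume x: "x \<in> N" and y: "y \<in> cells K" and le: "(x, y) \<in> face_order K"
  let ?t = "top_of K \<V> y"
  have t: "?t \<in> cells K"
    by (rule top_of_in_cells[OF y])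
  show "y \<in> N"
  \<comment> \<open>The arrows from a top into its closure skip its own multivector, so a cell
    \<open>x\<close> in the multivector of \<open>y\<close> is handled by compatibility
    instead.\<close>
  proof (cases "x \<in> mv_of \<V> y")
    case True
    then have "mv_of \<V> x = mv_of \<V> y"
      using mv_of_mv_of y by blast
    then show ?thesis
      using compat x mv_of_in(2)[OF y] unfolding mv_compatible_def by blast
  next
    case False
    have "(x, ?t) \<in> face_order K"
      using face_order_facts(3) le face_order_top_of[OF y] by (rule transD)
    then have "x \<in> Pi_mv K \<V> ?t"
      using False t y face_order_facts(1)
      by (auto simp: Pi_mv_def lef_cl_singleton mv_of_top_of top_of_top_of)
    then have "?t \<in> N"
      using N x t unfolding backward_trapping_region_def Pi_mv_inverse_def by blast
    then show ?thesis
      using mv_compatible_top_iff[OF compat y] by simp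
  qed
qed

text \<open>An arrow goes to the top of its own multivector, down in the face order, or nowhere.
  Read backwards, the first kind stays in \<open>Q\<close> by compatibility and the second by
  openness.\<close>

lemma open_compatible_backward_trapping:
  assumes compat: "mv_compatible K \<V> Q" and "openin (lefschetz_topology K) Q"
  shows "backward_trapping_region K \<V> Q"
proof -
  have "x \<in> Q" if x: "x \<in> cells K" and y: "y \<in> Pi_mv K \<V> x" "y \<in> Q" for x y
  proof -
    consider "y = top_of K \<V> x" | "(y, x) \<in> face_order K" | "x = y"
      using y(1) x by (auto simp: Pi_mv_def lef_cl_singleton)
    then show ?thesis
      using assms x y(2) mv_compatible_top_iff[OF compat x]
      by cases (auto simp: openin_lefschetz_topology)
  qed
  then show ?thesis
    using compat unfolding backward_trapping_region_def Pi_mv_inverse_def by blast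
qed

text \<open>For a predecessor \<open>x\<close> of \<open>y\<close>, the past of the top of
  \<open>x\<close> comes from invariance of the whole complex and is confined to \<open>N\<close>;
  its future is obtained by running through \<open>y\<close> and then the top of
  \<open>y\<close>.\<close>

lemma backward_trapping_Inv_part:
  assumes inv: "invariant_set K \<V> (cells K)" and N: "backward_trapping_region K \<V> N"
  shows "backward_trapping_region K \<V> (Inv_part K \<V> N)"
proof -
  have compat: "mv_compatible K \<V> N"
    using N by (simp add: backward_trapping_region_def)
  then have sub: "N \<subseteq> cells K"
    by (simp add: mv_compatible_def)
  note ker = mv_kernel_compatible[OF compat]
  have "x \<in> Inv_part K \<V> N"
    if x: "x \<in> cells K" and y: "y \<in> Pi_mv K \<V> x" "y \<in> Inv_part K \<V> N" for x y
  proof -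
    have yN: "y \<in> N" and fwd_top: "forward_solvable K \<V> N (top_of K \<V> y)"
      using y(2) by (simp_all add: Inv_part_iff ker)
    have xN: "x \<in> N"
      using N x y(1) yN unfolding backward_trapping_region_def Pi_mv_inverse_def by blast
    then have tN: "top_of K \<V> x \<in> N"
      using mv_compatible_top_iff[OF compat x] by simp
    have "backward_solvable K \<V> (cells K) (top_of K \<V> x)"
      using inv x by (metis Inv_part_iff invariant_set_def mv_compatible_cells mv_kernel_compatible)
    then have bwd: "backward_solvable K \<V> N (top_of K \<V> x)"
      by (rule backward_solvable_trapping[OF N tN])
    \<comment> \<open>Membership of \<open>y\<close> gives a future only for its top; when
      \<open>y\<close> is not that top, one arrow leads there.\<close>
    have fwd: "forward_solvable K \<V> N y"
    proof (cases "y = top_of K \<V> y")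
      case False
      moreover have "top_of K \<V> y \<in> cells K"
        using yN sub top_of_in_cells by blast
      ultimately have "top_of K \<V> y \<in> Pi_mv K \<V> y"
        by (simp add: Pi_mv_def)
      then show ?thesis
        using forward_solvable_step yN fwd_top by metis
    qed (use fwd_top in simp)
    have "forward_solvable K \<V> N (top_of K \<V> x)"
    \<comment> \<open>A top \<open>x\<close> is prepended to the future of \<open>y\<close>. From
      any other \<open>x\<close> the only arrow leads to its top, so \<open>y\<close> is that
      top.\<close>
    proof (cases "x = top_of K \<V> x")
      case True
      then show ?thesis
        using forward_solvable_step[OF xN y(1) fwd] by simp
    next
      case False
      then show ?thesis
        using fwd y(1) by (auto simp: Pi_mv_def)
    qed
    then show ?thesis
      using xN bwd by (simp add: Inv_part_iff ker)
  qed
  then show ?thesis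
    using mv_compatible_Inv_part[OF sub]
    unfolding backward_trapping_region_def Pi_mv_inverse_def by blast
qed

end

theorem theorem8p3:
  fixes K :: "('a, 'r::{ring, monoid_mult}) complex_data"
    and \<V> :: "'a set set" and Q :: "'a set"
  assumes "lefschetz_complex K"
    and "multivector_field K \<V>"
    and "invariant_set K \<V> (cells K)"
    and "Q \<subseteq> cells K"
  shows "(repeller K \<V> Q \<longleftrightarrow>
            invariant_set K \<V> Q \<and> openin (lefschetz_topology K) Q) \<and>
         (invariant_set K \<V> Q \<and> openin (lefschetz_topology K) Q \<longleftrightarrow>
            isolated_invariant_set K \<V> Q \<and> openin (lefschetz_topology K) Q) \<and>
         (isolated_invariant_set K \<V> Q \<and> openin (lefschetz_topology K) Q \<longleftrightarrow>
            isolated_invariant_set K \<V> Q \<and> openin (lefschetz_topology K) Q \<and>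
            backward_trapping_region K \<V> Q)"
proof -
  interpret multivector_field_on K \<V>
    by (rule multivector_field_on.intro[OF assms(1,2)])
  have rep: "invariant_set K \<V> Q \<and> openin (lefschetz_topology K) Q" if Q: "repeller K \<V> Q"
  proof -
    obtain N where N: "backward_trapping_region K \<V> N" "Q = Inv_part K \<V> N"
      using Q by (auto simp: repeller_def)
    then have "N \<subseteq> cells K"
      by (simp add: backward_trapping_region_def mv_compatible_def)
    then show ?thesis
      using N invariant_Inv_part backward_trapping_Inv_part[OF assms(3)] backward_trapping_open
      by blast
  qed
  \<comment> \<open>Compatibility of \<open>Q\<close> comes from
    \<open>Q = Inv_part K \<V> Q\<close>. The same equation then lets \<open>Q\<close> serve as its
    own trapping region in the definition of a repeller.\<close>
  have trap: "backward_trapping_region K \<V> Q"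
    if "invariant_set K \<V> Q" "openin (lefschetz_topology K) Q"
    using that open_compatible_backward_trapping mv_compatible_Inv_part
    by (metis invariant_set_def)
  then have "repeller K \<V> Q"
    if "invariant_set K \<V> Q" "openin (lefschetz_topology K) Q"
    using that unfolding repeller_def invariant_set_def by metis
  moreover have "invariant_set K \<V> Q" if "isolated_invariant_set K \<V> Q"
    using that by (simp add: isolated_invariant_set_def)
  ultimately show ?thesis
    using rep trap backward_trapping_isolated by blast
qed

end
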